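(* Let $a,b\ge 1$ and let $\rho$ be the canonical sequential form of a non-crossing partition of length $a$; if $b\ge 2$, assume further that $\rho$ starts with a single $1$ (i.e. its initial run of $1$'s has length exactly one), with no such restriction if $b=1$. Let $\tau=(\rho+1)1^b$. If $n\ge a+b-1$, then the total number of occurrences of the subword $\tau$ within all the members of $NC_n$, i.e. $\sum_{\pi\in NC_n}\mu_\tau(\pi)$, is $\binom{2r-2}{r+1}$, where $r=n-a-b+2$.
   Context: A set partition of $[n]=\{1,\dots,n\}$ with blocks $B_1,\dots,B_k$ ordered so that $\min B_1<\cdots<\min B_k$ is represented by its canonical sequential form $\pi=\pi_1\cdots\pi_n$, where $i\in B_{\pi_i}$ for each $i$; $n$ is its length. It is non-crossing if $\pi$ contains no (not necessarily consecutive) subsequence of the form $a\,b\,a\,b$ with $a<b$. $NC_n$ denotes the set of non-crossing partitions of $[n]$, identified with their canonical sequential forms. A subword pattern is a finite sequence $\tau=\tau_1\cdots\tau_k$ of positive integers whose set of distinct letters is $[\ell]$ for some $\ell$. An occurrence of $\tau$ in a sequence $\sigma_1\cdots\sigma_n$ is an index $i\in[n-k+1]$ such that the string of consecutive letters $\sigma_i\cdots\sigma_{i+k-1}$ is order-isomorphic to $\tau$ (same relative order, including equalities). $\mu_\tau(\pi)$ denotes the number of occurrences of $\tau$ in $\pi$. $\rho+1$ is the sequence obtained by adding $1$ to each entry of $\rho$, $1^b$ is the word of $b$ ones, and juxtaposition is concatenation. *)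

theory Defs
  imports Main "HOL-Library.Disjoint_Sets" "HOL-Library.Sublist"
begin

definition block_of :: "nat set set \<Rightarrow> nat \<Rightarrow> nat set" where
  "block_of P i = (THE B. B \<in> P \<and> i \<in> B)"

(* When the blocks are listed by increasing minimum, the position (counted from 1)
   of a block is the number of blocks whose minimum is at most its own. *)
definition block_index :: "nat set set \<Rightarrow> nat set \<Rightarrow> nat" where
  "block_index P B = card {C \<in> P. Min C \<le> Min B}"

definition canonical_form :: "nat \<Rightarrow> nat set set \<Rightarrow> nat list" where
  "canonical_form n P = map (\<lambda>i. block_index P (block_of P i)) [1..<Suc n]"

definition noncrossing :: "nat list \<Rightarrow> bool" where
  "noncrossing p \<longleftrightarrow> \<not> (\<exists>a b. a < b \<and> subseq [a, b, a, b] p)"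

definition NC :: "nat \<Rightarrow> nat list set" where
  "NC n = {p. noncrossing p \<and> (\<exists>P. partition_on {1..n} P \<and> p = canonical_form n P)}"

definition order_isomorphic :: "nat list \<Rightarrow> nat list \<Rightarrow> bool" where
  "order_isomorphic u v \<longleftrightarrow> length u = length v \<and>
     (\<forall>i<length u. \<forall>j<length u.
        (u ! i < u ! j \<longleftrightarrow> v ! i < v ! j) \<and> (u ! i = u ! j \<longleftrightarrow> v ! i = v ! j))"

(* The starting positions i are counted from 0. *)
definition occurrences :: "nat list \<Rightarrow> nat list \<Rightarrow> nat" where
  "occurrences t p =
     card {i. i + length t \<le> length p \<and> order_isomorphic (take (length t) (drop i p)) t}"

lemma finite_NC: "finite (NC n)"
proof (rule finite_subset)
  show "NC n \<subseteq> canonical_form n ` Pow (Pow {1..n})"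
    by (auto simp: NC_def partition_on_def)
  show "finite (canonical_form n ` Pow (Pow {1..n}))"
    by simp
qed

end

theory Submission
  imports Defs
begin

text \<open>
  Reading a non-crossing canonical form from left to right, call a letter open if it may still
  occur again: the next letter is either new or open, and it closes all larger open letters. Only the number of open letters matters for counting. In an occurrence
  of \<open>\<tau>\<close> every letter of the image of \<open>\<rho> + 1\<close> other than its smallest letter \<open>x\<close> must be new, so the
  occurrence is determined by \<open>x\<close> and the open letter \<open>y < x\<close> that takes the place of the final ones. The
  total therefore depends on \<open>a + b\<close> only, through a recurrence in the number of open letters
  that is solved by binomial coefficients.
\<close>

section \<open>Ranks in finite sets of naturals\<close>

lemma bij_betw_rank:
  fixes A :: "nat set"
  assumes "finite A"
  shows "bij_betw (\<lambda>x. card {y \<in> A. y \<le> x}) A {1..card A}"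
proof -
  let ?r = "\<lambda>x. card {y \<in> A. y \<le> x}"
  have less: "?r x < ?r y" if "x < y" "y \<in> A" for x y
  proof (rule psubset_card_mono)
    have "{z \<in> A. z \<le> x} \<subseteq> {z \<in> A. z \<le> y}" "y \<in> {z \<in> A. z \<le> y}" "y \<notin> {z \<in> A. z \<le> x}"
      using that by auto
    then show "{z \<in> A. z \<le> x} \<subset> {z \<in> A. z \<le> y}" by blast
  qed (use assms in simp)
  have inj: "inj_on ?r A"
    by (rule inj_onI) (metis less linorder_neqE_nat nat_neq_iff)
  have "?r x \<in> {1..card A}" if "x \<in> A" for x
  proof -
    have "?r x \<le> card A" by (rule card_mono) (use assms in auto)
    moreover have "?r x > 0" using that assms by (auto simp: card_gt_0_iff)
    ultimately show ?thesis by simp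
  qed
  then have "?r ` A \<subseteq> {1..card A}" by blast
  then have "?r ` A = {1..card A}"
    by (intro card_subset_eq) (auto simp: card_image[OF inj])
  with inj show ?thesis by (simp add: bij_betw_def)
qed

text \<open>When \<open>x\<close> runs over the letters that may come next, its rank among them is
  the number of letters left open after reading \<open>x\<close>. Sums over letters thus become sums
  over the number of open letters.\<close>

lemma sum_rank:
  fixes A :: "nat set" and g :: "nat \<Rightarrow> 'a::comm_monoid_add"
  assumes "finite A"
  shows "(\<Sum>x\<in>A. g (card {y \<in> A. y \<le> x})) = (\<Sum>j=1..card A. g j)"
  by (rule sum.reindex_bij_betw[OF bij_betw_rank[OF assms]])

section \<open>Restricted growth words and canonical forms\<close>

text \<open>Restricted growth: the word continues one whose letters are exactly \<open>1, \<dots>, m\<close>.\<close>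
fun rgf :: "nat \<Rightarrow> nat list \<Rightarrow> bool" where
  "rgf m [] \<longleftrightarrow> True"
| "rgf m (x # w) \<longleftrightarrow> 0 < x \<and> x \<le> Suc m \<and> rgf (max m x) w"

text \<open>This form without recursion can be checked position by position against the blocks of a
  partition.\<close>

lemma rgf_iff_nth:
  "rgf m w \<longleftrightarrow> (\<forall>i<length w. 0 < w ! i \<and> (\<forall>v. m < v \<and> v < w ! i \<longrightarrow> v \<in> set (take i w)))"
proof (induction w arbitrary: m)
  case (Cons x w)
  have "(\<forall>v. m < v \<and> v < x \<longrightarrow> False) \<longleftrightarrow> x \<le> Suc m"
    by (meson Suc_le_eq leD le_less_linear lessI less_le_trans not_less_eq_eq)
  moreover have "(\<forall>v. m < v \<and> v < w ! i \<longrightarrow> v = x \<or> v \<in> set (take i w)) \<longleftrightarrow>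
     (\<forall>v. max m x < v \<and> v < w ! i \<longrightarrow> v \<in> set (take i w))" if "x \<le> Suc m" for i
    using that by (metis Suc_leI le_antisym le_less_trans less_imp_le max_less_iff_conj
        nat_less_le)
  ultimately show ?case
    by (auto simp: Cons.IH All_less_Suc2)
qed simp

lemma length_canonical_form: "length (canonical_form n P) = n"
  by (simp add: canonical_form_def del: upt_Suc)

text \<open>The letter at a position is the rank of the minimum of its block \<open>D\<close>. A
  smaller letter \<open>v\<close> is the rank of the minimum of some block \<open>C\<close>, and
  \<open>Min C < Min D\<close>, so \<open>v\<close> already stands at the position of
  \<open>Min C\<close>.\<close>

lemma rgf_canonical_form:
  assumes P: "partition_on {1..n} P"
  shows "rgf 0 (canonical_form n P)"
proof -
  let ?p = "canonical_form n P"
  have finP: "finite P" using P finite_elements by blast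
  have B: "finite B" "B \<noteq> {}" "B \<subseteq> {1..n}" "Min B \<in> B" if "B \<in> P" for B
  proof -
    show sub: "B \<subseteq> {1..n}" using P that by (auto simp: partition_on_def)
    then show fin: "finite B" using finite_subset by blast
    show "B \<noteq> {}" using P that by (auto simp: partition_on_def)
    with fin show "Min B \<in> B" by simp
  qed
  have uniq: "B = C" if "B \<in> P" "C \<in> P" "i \<in> B" "i \<in> C" for B C i
    using P that by (auto simp: partition_on_def disjoint_def)
  have block_of: "block_of P i = B" if "B \<in> P" "i \<in> B" for B i
    unfolding block_of_def by (rule the_equality) (use that uniq in blast)+
  have inj: "inj_on Min P"
    by (rule inj_onI) (metis B(4) uniq)
  define A where "A = Min ` P"
  have idx: "block_index P B = card {y \<in> A. y \<le> Min B}" for B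
  proof -
    have "{y \<in> A. y \<le> Min B} = Min ` {C \<in> P. Min C \<le> Min B}" by (auto simp: A_def)
    moreover have "inj_on Min {C \<in> P. Min C \<le> Min B}" by (rule inj_on_subset[OF inj]) auto
    ultimately show ?thesis by (simp add: block_index_def card_image)
  qed
  have finA: "finite A" using finP by (simp add: A_def)
  have rank: "bij_betw (\<lambda>x. card {y \<in> A. y \<le> x}) A {1..card A}"
    by (rule bij_betw_rank[OF finA])
  \<comment> \<open>Elements of the ground set count from 1 and list positions from 0, hence the
    shift.\<close>
  have nth: "?p ! (i - 1) = block_index P B" if "B \<in> P" "i \<in> B" for B i
  proof -
    have "i \<in> {1..n}" using B(3) that by blast
    then show ?thesis
      using that by (cases i) (auto simp: canonical_form_def block_of simp del: upt_Suc)
  qed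
  show ?thesis
    unfolding rgf_iff_nth
  proof (intro allI impI conjI)
    fix i assume i: "i < length ?p"
    then have "Suc i \<in> {1..n}" by (simp add: canonical_form_def del: upt_Suc)
    then have "Suc i \<in> \<Union> P" by (simp only: partition_onD1[OF P, symmetric])
    then obtain D where D: "D \<in> P" "Suc i \<in> D" by blast
    have pi: "?p ! i = card {y \<in> A. y \<le> Min D}" using nth[OF D] idx by simp
    have MA: "Min D \<in> A" using D by (simp add: A_def)
    have range: "?p ! i \<in> {1..card A}"
      using bij_betw_apply[OF rank MA] pi by simp
    then show "0 < ?p ! i" by simp
    fix v assume v: "0 < v \<and> v < ?p ! i"
    then have "v \<in> {1..card A}" using range by auto
    then have "v \<in> (\<lambda>x. card {y \<in> A. y \<le> x}) ` A"
      using bij_betw_imp_surj_on[OF rank] by simp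
    then obtain c where "c \<in> A" "card {y \<in> A. y \<le> c} = v" by auto
    then obtain C where C: "C \<in> P" "card {y \<in> A. y \<le> Min C} = v"
      by (auto simp: A_def)
    have "Min C < Min D"
    proof (rule ccontr)
      assume "\<not> Min C < Min D"
      then have "card {y \<in> A. y \<le> Min D} \<le> card {y \<in> A. y \<le> Min C}"
        by (intro card_mono) (use finA in auto)
      then show False using v C pi by simp
    qed
    also have "Min D \<le> Suc i" using D B by auto
    finally have "Min C < Suc i" .
    moreover have "Min C \<in> {1..n}" using B(3,4)[OF C(1)] by blast
    ultimately have "Min C - 1 < i" by auto
    moreover have "?p ! (Min C - 1) = v" using nth[OF C(1) B(4)[OF C(1)]] idx C by simp
    ultimately show "v \<in> set (take i ?p)"
      using i by (auto simp: in_set_conv_nth intro!: exI[of _ "Min C - 1"])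
  qed
qed

text \<open>The fibres \<open>B v\<close> of the word serve as blocks. Restricted growth makes their
  minima increase with \<open>v\<close>, so the index of \<open>B v\<close> is \<open>v\<close>
  itself.\<close>

lemma canonical_form_of_rgf:
  assumes "rgf 0 p" and n: "length p = n"
  shows "\<exists>P. partition_on {1..n} P \<and> p = canonical_form n P"
proof -
  have pos: "0 < p ! i" if "i < n" for i using assms that by (auto simp: rgf_iff_nth)
  have before: "v \<in> set (take i p)" if "i < n" "0 < v" "v < p ! i" for i v
    using assms that by (auto simp: rgf_iff_nth)
  define B where "B v = {i \<in> {1..n}. p ! (i - 1) = v}" for v
  define P where "P = B ` set p"
  have finB: "finite (B v)" for v by (simp add: B_def)
  have neB: "B v \<noteq> {}" if v: "v \<in> set p" for v
  proof -
    obtain i where "i < n" "p ! i = v" using v n by (auto simp: in_set_conv_nth)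
    then have "Suc i \<in> B v" by (auto simp: B_def)
    then show ?thesis by blast
  qed
  have part: "partition_on {1..n} P"
  proof (rule partition_onI)
    show "\<Union> P = {1..n}"
    proof -
      have "i \<in> B (p ! (i - 1))" "p ! (i - 1) \<in> set p" if "i \<in> {1..n}" for i
        using that n by (auto simp: B_def)
      then show ?thesis by (fastforce simp: P_def B_def)
    qed
  next
    fix C D assume "C \<in> P" "D \<in> P" "C \<noteq> D"
    then show "disjnt C D" by (auto simp: P_def B_def disjnt_def)
  next
    show "{} \<notin> P" using neB by (auto simp: P_def)
  qed
  have Min_less: "Min (B v) < Min (B w)" if vw: "v \<in> set p" "w \<in> set p" "v < w" for v w
  proof -
    let ?j = "Min (B w)"
    have "?j \<in> B w" using finB neB vw by simp
    then have j: "?j \<in> {1..n}" "p ! (?j - 1) = w" by (auto simp: B_def)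
    have "0 < v" using vw pos n by (auto simp: in_set_conv_nth)
    with j vw have "v \<in> set (take (?j - 1) p)" by (intro before) auto
    then obtain i where i: "i < ?j - 1" "p ! i = v" using j n by (auto simp: in_set_conv_nth)
    then have "Suc i \<in> B v" using j by (auto simp: B_def)
    then have "Min (B v) \<le> Suc i" using finB by simp
    with i show ?thesis by simp
  qed
  then have Min_le: "Min (B u) \<le> Min (B v) \<longleftrightarrow> u \<le> v" if "u \<in> set p" "v \<in> set p" for u v
    using that by (metis leD le_less_linear less_imp_le nat_neq_iff order_refl)
  have idx: "block_index P (B v) = v" if v: "v \<in> set p" for v
  proof -
    have "{C \<in> P. Min C \<le> Min (B v)} = B ` {u \<in> set p. u \<le> v}"
      using Min_le v by (auto simp: P_def)
    \<comment> \<open>Every positive letter below an occurring letter has occurred before it, so the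
      rank of \<open>v\<close> among the letters is \<open>v\<close>.\<close>
    also have "{u \<in> set p. u \<le> v} = {1..v}"
    proof -
      obtain i where i: "i < n" "p ! i = v" using v n by (auto simp: in_set_conv_nth)
      have "u \<in> set p" if "u \<in> {1..v}" for u
        using that i v before[of i u] by (cases "u = v") (auto dest: in_set_takeD)
      moreover have "0 < u" if "u \<in> set p" for u
        using that pos n by (auto simp: in_set_conv_nth)
      ultimately show ?thesis by (auto simp: Suc_le_eq)
    qed
    finally have eq: "{C \<in> P. Min C \<le> Min (B v)} = B ` {1..v}" "{1..v} \<subseteq> set p"
      using \<open>{u \<in> set p. u \<le> v} = {1..v}\<close> by auto
    have "inj_on B {1..v}"
      by (rule inj_onI) (metis Min_less eq(2) linorder_neqE_nat nat_neq_iff subsetD)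
    then show ?thesis by (simp add: block_index_def eq card_image)
  qed
  have "p = canonical_form n P"
  proof (rule nth_equalityI)
    fix i assume i: "i < length p"
    have "Suc i \<in> B (p ! i)" "B (p ! i) \<in> P" using i n by (auto simp: B_def P_def)
    then have "block_of P (Suc i) = B (p ! i)"
      unfolding block_of_def
      by (intro the_equality) (use part in \<open>auto simp: partition_on_def disjoint_def\<close>)
    then show "p ! i = canonical_form n P ! i" using i n idx by (simp add: canonical_form_def del: upt_Suc)
  qed (simp add: canonical_form_def n)
  with part show ?thesis by blast
qed

section \<open>Non-crossing words as paths through states\<close>

text \<open>In state \<open>(S, m)\<close> the letters \<open>1, \<dots>, m\<close> have occurred and those in \<open>S\<close> are still open.\<close>
fun nc_word :: "nat set \<Rightarrow> nat \<Rightarrow> nat list \<Rightarrow> bool" where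
  "nc_word S m [] \<longleftrightarrow> True"
| "nc_word S m (x # w) \<longleftrightarrow>
     x \<in> insert (Suc m) S \<and> nc_word {y \<in> insert (Suc m) S. y \<le> x} (max m x) w"

text \<open>The letters of \<open>{1..m}\<close> have already occurred, in this order of first occurrence, so \<open>[a, b]\<close>
  with \<open>a < b \<le> m\<close> and \<open>[b, a, b]\<close> with \<open>a < b\<close> complete to crossings.\<close>
lemma nc_word_iff:
  assumes "S \<subseteq> {1..m}"
  shows "nc_word S m w \<longleftrightarrow> rgf m w \<and> (\<forall>x\<in>set w. x \<le> m \<longrightarrow> x \<in> S) \<and>
    (\<forall>a b. a < b \<and> b \<le> m \<longrightarrow> \<not> subseq [a, b] w) \<and> (\<forall>a b. a < b \<longrightarrow> \<not> subseq [b, a, b] w)"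
  using assms
proof (induction w arbitrary: S m)
  case (Cons x w)
  show ?case
  proof (cases "x = Suc m")
    case True
    have *: "{y \<in> insert (Suc m) S. y \<le> x} = insert (Suc m) S" using True Cons.prems by auto
    have "nc_word S m (x # w) \<longleftrightarrow> nc_word (insert (Suc m) S) (Suc m) w"
      using True * by simp
    also have "\<dots> \<longleftrightarrow> rgf (Suc m) w \<and> (\<forall>y\<in>set w. y \<le> Suc m \<longrightarrow> y \<in> insert (Suc m) S) \<and>
      (\<forall>a b. a < b \<and> b \<le> Suc m \<longrightarrow> \<not> subseq [a, b] w) \<and> (\<forall>a b. a < b \<longrightarrow> \<not> subseq [b, a, b] w)"
      by (rule Cons.IH) (use Cons.prems in auto)
    also have "(\<forall>a b. a < b \<and> b \<le> Suc m \<longrightarrow> \<not> subseq [a, b] w) \<and> (\<forall>a b. a < b \<longrightarrow> \<not> subseq [b, a, b] w) \<longleftrightarrow>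
      (\<forall>a b. a < b \<and> b \<le> m \<longrightarrow> \<not> subseq [a, b] (x # w)) \<and> (\<forall>a b. a < b \<longrightarrow> \<not> subseq [b, a, b] (x # w))"
      (is "?L \<longleftrightarrow> ?R")
    proof
      show "?L \<Longrightarrow> ?R" using True by auto
      assume R: ?R
      \<comment> \<open>The new letter \<open>x\<close> in front would turn \<open>[a, x]\<close>
        into the forbidden \<open>[x, a, x]\<close>.\<close>
      have "\<not> subseq [a, x] w" if "a < x" for a
        using R that by (metis subseq_Cons2)
      moreover have "\<not> subseq [a, b] w" if "a < b" "b \<le> m" for a b
        using R that by (meson list_emb_Cons)
      moreover have "\<not> subseq [b, a, b] w" if "a < b" for a b
        using R that by (meson list_emb_Cons)
      ultimately show ?L using True by (auto simp: le_Suc_eq)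
    qed
    finally show ?thesis using True by (auto simp: le_Suc_eq)
  next
    case False
    show ?thesis
    proof (cases "x \<in> S")
      case True
      then have x: "1 \<le> x" "x \<le> m" using Cons.prems by auto
      have *: "{y \<in> insert (Suc m) S. y \<le> x} = {y \<in> S. y \<le> x}" using x by auto
      have "nc_word S m (x # w) \<longleftrightarrow> nc_word {y \<in> S. y \<le> x} m w"
        using True x * by simp
      also have "\<dots> \<longleftrightarrow> rgf m w \<and> (\<forall>y\<in>set w. y \<le> m \<longrightarrow> y \<in> {y \<in> S. y \<le> x}) \<and>
        (\<forall>a b. a < b \<and> b \<le> m \<longrightarrow> \<not> subseq [a, b] w) \<and> (\<forall>a b. a < b \<longrightarrow> \<not> subseq [b, a, b] w)"
        by (rule Cons.IH) (use Cons.prems in auto)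
      \<comment> \<open>Closing the letters above \<open>x\<close> matches the ban on old pairs: an
        old letter \<open>y > x\<close> later in \<open>w\<close> would complete
        \<open>[x, y]\<close> in \<open>x # w\<close>.\<close>
      also have "(\<forall>y\<in>set w. y \<le> m \<longrightarrow> y \<in> {y \<in> S. y \<le> x}) \<and>
          (\<forall>a b. a < b \<and> b \<le> m \<longrightarrow> \<not> subseq [a, b] w) \<and> (\<forall>a b. a < b \<longrightarrow> \<not> subseq [b, a, b] w) \<longleftrightarrow>
        (\<forall>y\<in>set (x # w). y \<le> m \<longrightarrow> y \<in> S) \<and>
          (\<forall>a b. a < b \<and> b \<le> m \<longrightarrow> \<not> subseq [a, b] (x # w)) \<and>
          (\<forall>a b. a < b \<longrightarrow> \<not> subseq [b, a, b] (x # w))"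
        (is "?L \<longleftrightarrow> ?R")
      proof
        assume L: ?L
        then have "y \<in> S" if "y \<in> set (x # w)" "y \<le> m" for y
          using True that by auto
        moreover have "\<not> subseq [a, b] (x # w)" if "a < b" "b \<le> m" for a b
        proof
          assume sub: "subseq [a, b] (x # w)"
          have "\<not> subseq [a, b] w" using L that by blast
          with sub have "a = x" "b \<in> set w" by (auto simp: subseq_singleton_left split: if_splits)
          then show False using L that by auto
        qed
        moreover have "\<not> subseq [b, a, b] (x # w)" if "a < b" for a b
        proof
          assume sub: "subseq [b, a, b] (x # w)"
          have "\<not> subseq [b, a, b] w" using L that by blast
          with sub have "b = x" "subseq [a, x] w" by (auto split: if_splits)
          then show False using L that x by blast
        qed
        ultimately show ?R by blast
      next
        assume R: ?R
        then have "y \<in> S" "y \<le> x" if "y \<in> set w" "y \<le> m" for y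
        proof -
          show "y \<in> S" using R that by simp
          have "subseq [x, y] (x # w)" using that by (simp add: subseq_singleton_left)
          then show "y \<le> x" using R that(2) by (meson not_le)
        qed
        moreover have "\<not> subseq [a, b] w" if "a < b" "b \<le> m" for a b
          using R that by (meson list_emb_Cons)
        moreover have "\<not> subseq [b, a, b] w" if "a < b" for a b
          using R that by (meson list_emb_Cons)
        ultimately show ?L by blast
      qed
      also have "rgf m w \<longleftrightarrow> rgf m (x # w)" using x by (simp add: max_absorb1)
      finally show ?thesis .
    next
      assume "x \<notin> S"
      with False show ?thesis by auto
    qed
  qed
qed simp

text \<open>Letters above \<open>m\<close> make their first appearances in increasing order, so an
  \<open>a\<close> precedes the first \<open>b\<close>. A first letter other than \<open>a\<close>
  must be below \<open>a\<close>, which keeps the running maximum below \<open>a\<close> in the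
  induction.\<close>

lemma subseq_abab_of_bab:
  assumes "rgf m w" "subseq [b, a, b] w" "m < a" "a < b"
  shows "subseq [a, b, a, b] w"
  using assms
proof (induction w arbitrary: m)
  case (Cons x w)
  show ?case
  proof (cases "x = a")
    case True
    with Cons.prems show ?thesis by (auto split: if_splits)
  next
    case False
    then have "x < a" using Cons.prems by auto
    with Cons.prems have "subseq [a, b, a, b] w"
      by (intro Cons.IH[of "max m x"]) (auto split: if_splits)
    then show ?thesis by (rule list_emb_Cons)
  qed
qed simp

text \<open>In the state \<open>({}, 0)\<close> the conditions on old letters in
  \<open>nc_word_iff\<close> are vacuous, since all letters are positive. What remains is restricted
  growth and the absence of \<open>[b, a, b]\<close>, which is equivalent to non-crossing by
  \<open>subseq_abab_of_bab\<close>.\<close>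

lemma NC_eq_nc_word: "NC n = {w. length w = n \<and> nc_word {} 0 w}"
proof -
  have pos: "0 < x" if "rgf 0 p" "x \<in> set p" for p x
    using that by (auto simp: rgf_iff_nth in_set_conv_nth)
  have "noncrossing p \<longleftrightarrow> (\<forall>a b. a < b \<longrightarrow> \<not> subseq [b, a, b] p)" if "rgf 0 p" for p
  proof
    assume nc: "noncrossing p"
    show "\<forall>a b. a < b \<longrightarrow> \<not> subseq [b, a, b] p"
    proof (intro allI impI notI)
      fix a b assume ab: "a < b" "subseq [b, a, b] p"
      have "a \<in> set p" by (rule list_emb_set[OF ab(2), of a]) auto
      then have "subseq [a, b, a, b] p"
        using pos[OF that] ab by (intro subseq_abab_of_bab[OF that]) auto
      with nc ab show False by (auto simp: noncrossing_def)
    qed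
  next
    assume bab: "\<forall>a b. a < b \<longrightarrow> \<not> subseq [b, a, b] p"
    show "noncrossing p" unfolding noncrossing_def
    proof
      assume "\<exists>a b. a < b \<and> subseq [a, b, a, b] p"
      then obtain a b where "a < b" "subseq [a, b, a, b] p" by blast
      with bab subseq_Cons'[of a "[b, a, b]" p] show False by simp
    qed
  qed
  then have "nc_word {} 0 p \<longleftrightarrow> rgf 0 p \<and> noncrossing p" for p
    using pos by (subst nc_word_iff) (auto simp: subseq_singleton_left)
  moreover have "(\<exists>P. partition_on {1..n} P \<and> p = canonical_form n P) \<longleftrightarrow> rgf 0 p \<and> length p = n" for p
    using rgf_canonical_form canonical_form_of_rgf length_canonical_form by blast
  ultimately show ?thesis unfolding NC_def by blast
qed

section \<open>Solving the recurrences by binomial coefficients\<close>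

text \<open>\<open>walks k h\<close> counts the continuations by \<open>k\<close> letters when \<open>h\<close> letters are open; \<open>marked_walks k h\<close>
  counts them with a marked occurrence of the pattern, whose letters are not counted in \<open>k\<close>. There
  \<open>i\<close> and \<open>j\<close> are the numbers of open letters after \<open>x\<close> and after \<open>y\<close>.\<close>
fun walks :: "nat \<Rightarrow> nat \<Rightarrow> nat" where
  "walks 0 h = 1"
| "walks (Suc k) h = (\<Sum>j=1..Suc h. walks k j)"

fun marked_walks :: "nat \<Rightarrow> nat \<Rightarrow> nat" where
  "marked_walks 0 h = (\<Sum>i=1..Suc h. \<Sum>j=1..<i. walks 0 j)"
| "marked_walks (Suc k) h =
     (\<Sum>i=1..Suc h. \<Sum>j=1..<i. walks (Suc k) j) + (\<Sum>j=1..Suc h. marked_walks k j)"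

lemma walks_Suc_Suc: "walks (Suc k) (Suc h) = walks (Suc k) h + walks k (Suc (Suc h))"
  by simp

text \<open>These are ballot numbers: by Pascal's rule the difference satisfies
  \<open>walks_Suc_Suc\<close>. Integers are used because of the subtraction, and starting at
  \<open>Suc k\<close> avoids a lower index \<open>k - 1\<close>.\<close>

lemma walks_closed:
  "int (walks (Suc k) h) =
     int ((2 * k + h + 2) choose (Suc k)) - int ((2 * k + h + 2) choose k)"
proof (induction k arbitrary: h)
  case 0
  show ?case by simp
next
  case (Suc k)
  note IH = Suc.IH
  show ?case
  proof (induction h)
    case 0
    \<comment> \<open>The boundary value satisfies \<open>walks (k + 2) 0 = walks (k + 1) 1\<close>;
      the two middle entries of an odd row of Pascal's triangle make the formulas agree
      there.\<close>
    have "(2 * k + 3) choose (k + 2) = (2 * k + 3) choose (k + 1)"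
      by (subst binomial_symmetric) auto
    then show ?case using IH[of 1] by (simp add: numeral_eq_Suc)
  next
    case (Suc h)
    show ?case
      using Suc IH[of "Suc (Suc h)"] by (simp add: walks_Suc_Suc numeral_eq_Suc del: walks.simps)
  qed
qed

text \<open>Raising \<open>h\<close> by one adds a single term to each outer sum; the added inner
  sum is itself a value of \<open>walks\<close>.\<close>

lemma marked_walks_Suc_Suc:
  "marked_walks (Suc k) (Suc h) =
     marked_walks (Suc k) h + marked_walks k (Suc (Suc h)) + walks (Suc (Suc k)) h"
proof -
  have "(\<Sum>j=1..<Suc (Suc h). walks (Suc k) j) = walks (Suc (Suc k)) h"
    by (simp add: atLeastLessThanSuc_atLeastAtMost del: sum.op_ivl_Suc sum.cl_ivl_Suc)
  then show ?thesis
    by (simp del: walks.simps sum.op_ivl_Suc)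
qed

text \<open>The two binomial terms solve the inhomogeneous recurrence
  \<open>marked_walks_Suc_Suc\<close> and its boundary condition at \<open>h = 0\<close>. The
  difference of the two \<open>walks\<close> terms solves the homogeneous version and corrects the
  values at \<open>k = 0\<close>.\<close>

lemma marked_walks_closed:
  "int (marked_walks k h) = int h * int ((2 * k + 2 + h) choose (k + 1)) +
     int ((2 * k + 2 + h) choose k) + int (walks (k + 1) h) - int (walks (k + 2) h)"
proof (induction k arbitrary: h)
  case 0
  have "int (\<Sum>i=1..Suc h. \<Sum>j=1..<i. walks 0 j) + int (walks 2 h) = int h * (int h + 2) + 1 + (int h + 1)"
    by (induction h) (simp_all add: numeral_eq_Suc algebra_simps)
  then show ?case by (simp add: numeral_eq_Suc algebra_simps)
next
  case (Suc k)
  note IH = Suc.IH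
  show ?case
  proof (induction h)
    case 0
    have "walks (k + 2) 0 = walks (k + 1) 1" "walks (k + 3) 0 = walks (k + 2) 1"
      by (simp_all add: numeral_eq_Suc)
    moreover have "marked_walks (Suc k) 0 = marked_walks k 1" by simp
    ultimately show ?case using IH[of 1]
      by (simp add: numeral_eq_Suc del: walks.simps marked_walks.simps)
  next
    case (Suc h)
    have "int (walks (Suc (Suc k)) h) =
     int ((2 * Suc k + h + 2) choose (Suc (Suc k))) - int ((2 * Suc k + h + 2) choose (Suc k))"
      by (rule walks_closed)
    then show ?case
      using Suc IH[of "Suc (Suc h)"]
      by (simp add: walks_Suc_Suc marked_walks_Suc_Suc numeral_eq_Suc algebra_simps del: walks.simps marked_walks.simps)
  qed
qed

text \<open>Two applications of Pascal's rule bring row \<open>2 * k + 4\<close> down to row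
  \<open>2 * k + 2\<close>; by symmetry everything but one entry cancels. With
  \<open>r = k + 2\<close> this is the binomial coefficient of the theorem.\<close>

lemma marked_walks_0: "marked_walks k 0 = (2 * k + 2) choose (k + 3)"
proof -
  have "int (marked_walks k 0) = int ((2 * k + 2) choose k) + int (walks (Suc k) 0) - int (walks (Suc (Suc k)) 0)"
    using marked_walks_closed[of k 0] by simp
  also have "\<dots> = int ((2 * k + 2) choose k) + (int ((2 * k + 2) choose (Suc k)) - int ((2 * k + 2) choose k))
    - (int ((2 * k + 4) choose (Suc (Suc k))) - int ((2 * k + 4) choose (Suc k)))"
    by (simp add: walks_closed numeral_eq_Suc del: walks.simps binomial_Suc_Suc)
  also have "\<dots> = int ((2 * k + 2) choose (k + 3))"
  proof -
    have c: "(2 * k + 4) choose (k + 2) = ((2*k+2) choose (k+2)) + 2 * ((2*k+2) choose (k+1)) + ((2*k+2) choose k)"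
      by (simp add: numeral_eq_Suc)
    have d: "(2 * k + 4) choose (k + 1) = (2 * k + 4) choose (k + 3)"
      by (subst binomial_symmetric) auto
    have e: "(2 * k + 4) choose (k + 3) = ((2*k+2) choose (k+3)) + 2 * ((2*k+2) choose (k+2)) + ((2*k+2) choose (k+1))"
      by (simp add: numeral_eq_Suc)
    have f: "(2 * k + 2) choose (k + 2) = (2 * k + 2) choose k"
      by (subst binomial_symmetric) auto
    show ?thesis using c d e f by (simp del: binomial_Suc_Suc)
  qed
  finally show ?thesis by simp
qed

section \<open>Counting words from an arbitrary state\<close>

definition nc_words :: "nat set \<Rightarrow> nat \<Rightarrow> nat \<Rightarrow> nat list set" where
  "nc_words S m n = {w. length w = n \<and> nc_word S m w}"

lemma nc_words_0: "nc_words S m 0 = {[]}"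
  by (auto simp: nc_words_def)

lemma nc_words_Suc:
  "nc_words S m (Suc n) = (\<Union>x\<in>insert (Suc m) S. (#) x `
     nc_words {y \<in> insert (Suc m) S. y \<le> x} (max m x) n)"
  by (fastforce simp: nc_words_def length_Suc_conv)

lemma finite_nc_words: "finite S \<Longrightarrow> finite (nc_words S m n)"
  by (induction n arbitrary: S m) (auto simp: nc_words_0 nc_words_Suc)

lemma sum_nc_words_Suc:
  assumes "finite S"
  shows "(\<Sum>w\<in>nc_words S m (Suc n). g w) = (\<Sum>x\<in>insert (Suc m) S.
     \<Sum>w\<in>nc_words {y \<in> insert (Suc m) S. y \<le> x} (max m x) n. g (x # w))"
proof -
  have "(\<Sum>w\<in>nc_words S m (Suc n). g w) = (\<Sum>x\<in>insert (Suc m) S.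
     sum g ((#) x ` nc_words {y \<in> insert (Suc m) S. y \<le> x} (max m x) n))"
    unfolding nc_words_Suc
    by (rule sum.UNION_disjoint) (use assms finite_nc_words in auto)
  then show ?thesis by (simp add: sum.reindex)
qed

lemma card_insert_Suc_max: "S \<subseteq> {1..m} \<Longrightarrow> card (insert (Suc m) S) = Suc (card S)"
  by (subst card_insert_disjoint) (auto intro: finite_subset)

text \<open>The ranks of the \<open>Suc (card S)\<close> possible next letters are
  \<open>1, ..., Suc (card S)\<close>, and each rank is the size of the next open set. Hence
  \<open>S\<close> enters only through its size.\<close>

lemma card_nc_words: "S \<subseteq> {1..m} \<Longrightarrow> card (nc_words S m n) = walks n (card S)"
proof (induction n arbitrary: S m)
  case 0
  then show ?case by (simp add: nc_words_0)
next
  case (Suc n)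
  let ?A = "insert (Suc m) S"
  have fin: "finite S" using Suc.prems finite_subset by blast
  have "card (nc_words S m (Suc n)) = (\<Sum>x\<in>?A. card (nc_words {y \<in> ?A. y \<le> x} (max m x) n))"
    using sum_nc_words_Suc[OF fin, of "\<lambda>_. 1::nat" m n] by simp
  also have "\<dots> = (\<Sum>x\<in>?A. walks n (card {y \<in> ?A. y \<le> x}))"
    by (intro sum.cong refl Suc.IH) (use Suc.prems in auto)
  also have "\<dots> = walks (Suc n) (card S)"
    using fin Suc.prems by (simp only: sum_rank finite_insert card_insert_Suc_max walks.simps)
  finally show ?case .
qed

section \<open>Inserting a copy of the pattern into a word\<close>

text \<open>Spreads the letters of a pattern with initial letter 1 over a word: 1 becomes the letter
  \<open>x\<close>, and the letters above 1 become the new letters following the current maximum \<open>M\<close>.\<close>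
definition spread :: "nat \<Rightarrow> nat \<Rightarrow> nat \<Rightarrow> nat" where
  "spread x M v = (if v \<le> 1 then x else M + v - 1)"

lemma spread_less_iff: "x \<le> M \<Longrightarrow> 0 < u \<Longrightarrow> 0 < v \<Longrightarrow> spread x M u < spread x M v \<longleftrightarrow> u < v"
  by (auto simp: spread_def)

lemma spread_eq_iff: "x \<le> M \<Longrightarrow> 0 < u \<Longrightarrow> 0 < v \<Longrightarrow> spread x M u = spread x M v \<longleftrightarrow> u = v"
  by (auto simp: spread_def)

lemma spread_ge: "x \<le> M \<Longrightarrow> x \<le> spread x M v"
  by (auto simp: spread_def)

text \<open>Repeating the largest open letter closes nothing and leaves the state unchanged.\<close>

lemma nc_word_replicate_append:
  assumes "y \<in> S" "y \<le> m" "\<forall>z\<in>S. z \<le> y"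
  shows "nc_word S m (replicate c y @ v) \<longleftrightarrow> nc_word S m v"
proof (induction c)
  case (Suc c)
  have "{z \<in> insert (Suc m) S. z \<le> y} = S" using assms by auto
  then show ?case using assms Suc by (simp add: max_absorb1)
qed simp

text \<open>The state \<open>(R, k)\<close> of the pattern is carried along inside the state of the
  word. The letter 1 goes to \<open>x\<close>, so \<open>k\<close> pattern letters account for only
  \<open>k - 1\<close> letters above \<open>M\<close>. The final \<open>y < x\<close> closes every
  spread letter, since all of them are at least \<open>x\<close>.\<close>

lemma nc_word_spread_append:
  assumes "nc_word R k u" "R \<subseteq> {1..k}" "1 \<le> k" "x \<le> M"
    "\<forall>z\<in>S. z \<le> x" "y \<in> S" "y < x"
  shows "nc_word (S \<union> spread x M ` R) (M + k - 1) (map (spread x M) u @ y # v) \<longleftrightarrow>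
    nc_word {z \<in> S. z \<le> y} (M + fold max u k - 1) v"
  using assms(1-3)
proof (induction u arbitrary: R k)
  case Nil
  have "\<not> spread x M z \<le> y" for z
    using spread_ge[OF assms(4), of z] assms(7) by simp
  then have "{z \<in> insert (Suc (M + k - 1)) (S \<union> spread x M ` R). z \<le> y} = {z \<in> S. z \<le> y}"
    using assms(4,7) by auto
  moreover have "max (M + k - 1) y = M + k - 1" using assms Nil by auto
  ultimately show ?case using assms by simp
next
  case (Cons a u)
  let ?f = "spread x M"
  have a: "a \<in> insert (Suc k) R" "1 \<le> a" using Cons.prems by auto
  \<comment> \<open>A letter that is new in the pattern becomes exactly the next new letter of the
    word.\<close>
  have new: "?f (Suc k) = Suc (M + k - 1)" using Cons.prems by (auto simp: spread_def)
  then have mem: "?f a \<in> insert (Suc (M + k - 1)) (S \<union> ?f ` R)" using a by auto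
  have "{z \<in> insert (Suc (M + k - 1)) (S \<union> ?f ` R). z \<le> ?f a} =
      S \<union> ?f ` {z \<in> insert (Suc k) R. z \<le> a}"
  proof -
    have "{z \<in> insert (Suc (M + k - 1)) (S \<union> ?f ` R). z \<le> ?f a} =
      {z \<in> S. z \<le> ?f a} \<union> {z \<in> ?f ` insert (Suc k) R. z \<le> ?f a}" using new by auto
    also have "{z \<in> S. z \<le> ?f a} = S" using assms(4,5) spread_ge[of x M a] by auto
    also have "{z \<in> ?f ` insert (Suc k) R. z \<le> ?f a} = ?f ` {z \<in> insert (Suc k) R. z \<le> a}"
    proof -
      have "?f z \<le> ?f a \<longleftrightarrow> z \<le> a" if "z \<in> insert (Suc k) R" for z
        using spread_less_iff[of x M a z] that a Cons.prems(2) assms(4) by (auto simp: not_less[symmetric])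
      then show ?thesis by blast
    qed
    finally show ?thesis .
  qed
  moreover have "max (M + k - 1) (?f a) = M + max k a - 1"
    using a assms(4) Cons.prems by (auto simp: spread_def)
  ultimately have "nc_word (S \<union> ?f ` R) (M + k - 1) (map ?f (a # u) @ y # v) \<longleftrightarrow>
    nc_word (S \<union> ?f ` {z \<in> insert (Suc k) R. z \<le> a}) (M + max k a - 1) (map ?f u @ y # v)"
    using mem by simp
  also have "\<dots> \<longleftrightarrow> nc_word {z \<in> S. z \<le> y} (M + fold max u (max k a) - 1) v"
    by (rule Cons.IH) (use Cons.prems in auto)
  finally show ?case by (simp add: max.commute)
qed

lemma le_fold_max: "k \<le> fold max u (k :: nat)"
proof (induction u arbitrary: k)
  case (Cons a u)
  show ?case using Cons[of "max a k"] by simp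
qed simp

text \<open>Reading \<open>x\<close> starts the pattern in the state \<open>({1}, 1)\<close>; the
  first \<open>y\<close> closes the whole copy and the other copies of \<open>y\<close> change
  nothing. The inserted prefix is always admissible, so only \<open>v\<close> is
  constrained.\<close>

lemma nc_word_occurrence_iff:
  assumes "nc_word {1} 1 u" "x \<in> insert (Suc m) S" "y \<in> S" "y < x" "S \<subseteq> {1..m}"
  shows "nc_word S m (map (spread x (max m x)) (1 # u) @ replicate (Suc c) y @ v) \<longleftrightarrow>
    nc_word {z \<in> S. z \<le> y} (max m x + fold max u 1 - 1) v"
proof -
  let ?M = "max m x" let ?S = "{z \<in> insert (Suc m) S. z \<le> x}"
  have one: "spread x ?M 1 = x" by (simp add: spread_def)
  have "nc_word S m (map (spread x ?M) (1 # u) @ replicate (Suc c) y @ v) \<longleftrightarrow>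
    nc_word (?S \<union> spread x ?M ` {1}) (?M + 1 - 1) (map (spread x ?M) u @ y # replicate c y @ v)"
  proof -
    have "?S \<union> spread x ?M ` {1} = ?S" using assms one by auto
    then show ?thesis using assms one by simp
  qed
  also have "\<dots> \<longleftrightarrow> nc_word {z \<in> ?S. z \<le> y} (?M + fold max u 1 - 1) (replicate c y @ v)"
    by (rule nc_word_spread_append) (use assms in auto)
  also have "{z \<in> ?S. z \<le> y} = {z \<in> S. z \<le> y}" using assms by auto
  also have "nc_word {z \<in> S. z \<le> y} (?M + fold max u 1 - 1) (replicate c y @ v) \<longleftrightarrow>
    nc_word {z \<in> S. z \<le> y} (?M + fold max u 1 - 1) v"
  proof (rule nc_word_replicate_append)
    show "y \<le> ?M + fold max u 1 - 1" using le_fold_max[of 1 u] assms by auto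
  qed (use assms in auto)
  finally show ?thesis .
qed

lemma order_isomorphic_nth:
  assumes "order_isomorphic u v" "i < length u" "j < length u"
  shows "u ! i < u ! j \<longleftrightarrow> v ! i < v ! j" "u ! i = u ! j \<longleftrightarrow> v ! i = v ! j"
  using assms unfolding order_isomorphic_def by blast+

section \<open>Occurrences at the front of a word\<close>

text \<open>A letter of the pattern that is larger than all previous ones forces a new letter in the word,
  and new letters of both sequences come in their natural order.\<close>
lemma order_isomorphic_rgf_imp_spread:
  assumes "order_isomorphic (map (spread x M) q @ w) (q @ u)"
    and "set q = {1..k}" "1 \<le> k" "rgf k u" "rgf (M + k - 1) w" "x \<le> M" "\<forall>z\<in>set w. z \<le> M \<longrightarrow> z = x"
  shows "w = map (spread x M) u"
  using assms(1-5,7)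
proof (induction u arbitrary: q k w)
  case Nil
  then show ?case by (simp add: order_isomorphic_def)
next
  case (Cons a u)
  let ?f = "spread x M"
  have "length w = Suc (length u)" using Cons.prems(1) by (simp add: order_isomorphic_def)
  then obtain z w' where w: "w = z # w'" by (auto simp: length_Suc_conv)
  have cmp: "(?f b < z \<longleftrightarrow> b < a) \<and> (?f b = z \<longleftrightarrow> b = a)" if b: "b \<in> set q" for b
  proof -
    obtain j where j: "j < length q" "q ! j = b" using b by (auto simp: in_set_conv_nth)
    let ?l = "map ?f q @ w" and ?r = "q @ a # u"
    have "j < length ?l" "length q < length ?l" using j w by auto
    then have "(?l ! j < ?l ! length q \<longleftrightarrow> ?r ! j < ?r ! length q) \<and>
        (?l ! j = ?l ! length q \<longleftrightarrow> ?r ! j = ?r ! length q)"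
      using order_isomorphic_nth[OF Cons.prems(1)] by blast
    then show ?thesis using j w by (simp add: nth_append)
  qed
  have a: "1 \<le> a" "a \<le> Suc k" and rgf: "rgf (max k a) u" using Cons.prems by auto
  have z: "z \<le> M + k" and rgfw: "rgf (max (M + k - 1) z) w'" using Cons.prems w by auto
  have "z = ?f a"
  proof (cases "a \<le> k")
    case True
    \<comment> \<open>Here \<open>a\<close> already stands in \<open>q\<close>, so \<open>z\<close>
      must equal its image.\<close>
    then show ?thesis using cmp[of a] Cons.prems a by auto
  next
    case False
    then have ak: "a = Suc k" using a by simp
    \<comment> \<open>Since \<open>a\<close> exceeds all earlier pattern letters, \<open>z\<close>
      exceeds \<open>x\<close>, hence \<open>M\<close>, and also the image of \<open>k\<close>. This
      gives \<open>z \<ge> M + k\<close>, and restricted growth gives the reverse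
      inequality.\<close>
    have "x < z" using cmp[of 1] Cons.prems ak by (auto simp: spread_def)
    then have "M < z" using Cons.prems w by (metis leI list.set_intros(1) nat_neq_iff)
    moreover have "?f k < z" using cmp[of k] Cons.prems ak by auto
    ultimately have "M + k - 1 < z" by (auto simp: spread_def split: if_splits)
    then show ?thesis using z ak Cons.prems by (simp add: spread_def)
  qed
  moreover have "w' = map ?f u"
  proof (rule Cons.IH)
    show "order_isomorphic (map ?f (q @ [a]) @ w') ((q @ [a]) @ u)"
      using Cons.prems(1) w \<open>z = ?f a\<close> by simp
    show "set (q @ [a]) = {1..max k a}" using Cons.prems a by auto
    have "max (M + k - 1) z = M + max k a - 1"
      using \<open>z = ?f a\<close> a assms(6) Cons.prems by (auto simp: spread_def)
    then show "rgf (M + max k a - 1) w'" using rgfw by simp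
  qed (use Cons.prems a rgf w in auto)
  ultimately show ?case using w by simp
qed

lemma order_isomorphic_spread:
  assumes "x \<le> M" "y < x" "\<forall>v\<in>set \<rho>. 0 < v"
  shows "order_isomorphic (map (spread x M) \<rho> @ replicate c y) (map Suc \<rho> @ replicate c 1)"
proof -
  have pos: "0 < \<rho> ! i" if "i < length \<rho>" for i using assms that by simp
  have gt: "y < spread x M v" for v using spread_ge[OF assms(1), of v] assms(2) by simp
  have gt': "\<not> spread x M v < y" "spread x M v \<noteq> y" "y \<noteq> spread x M v" for v using gt[of v] by auto
  show ?thesis
    unfolding order_isomorphic_def
    by (auto simp: nth_append gt gt' pos assms(1) spread_less_iff spread_eq_iff)
qed

text \<open>One direction is \<open>order_isomorphic_spread\<close>. For the other, the prefix is
  cut into a part \<open>p\<close> isomorphic to \<open>\<rho>\<close> and a part \<open>r\<close>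
  matching the final ones; \<open>r\<close> is constant and lies below \<open>x\<close>, and
  \<open>p\<close> is forced to be a spread copy.\<close>

lemma order_isomorphic_pattern_iff:
  assumes S: "S \<subseteq> {1..m}" and w: "nc_word S m w" and u: "nc_word {1} 1 u"
    and \<rho>: "\<rho> = 1 # u" and len: "length \<rho> + Suc c \<le> length w"
  shows "order_isomorphic (take (length \<rho> + Suc c) w) (map Suc \<rho> @ replicate (Suc c) 1) \<longleftrightarrow>
    (\<exists>x\<in>insert (Suc m) S. \<exists>y\<in>S. y < x \<and>
      (\<exists>v. w = map (spread x (max m x)) \<rho> @ replicate (Suc c) y @ v))"
proof
  have rgf_u: "rgf 1 u" using u by (subst (asm) nc_word_iff) auto
  then have pos_u: "0 < u ! i" if "i < length u" for i
    using that by (auto simp: rgf_iff_nth)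
  {
    assume "\<exists>x\<in>insert (Suc m) S. \<exists>y\<in>S. y < x \<and>
      (\<exists>v. w = map (spread x (max m x)) \<rho> @ replicate (Suc c) y @ v)"
    then obtain x y v where xy: "y < x" "w = map (spread x (max m x)) \<rho> @ replicate (Suc c) y @ v"
      by blast
    have "take (length \<rho> + Suc c) w = map (spread x (max m x)) \<rho> @ replicate (Suc c) y"
      using xy by simp
    moreover have "\<forall>v\<in>set \<rho>. 0 < v"
      using pos_u \<rho> by (auto simp: in_set_conv_nth)
    ultimately show "order_isomorphic (take (length \<rho> + Suc c) w) (map Suc \<rho> @ replicate (Suc c) 1)"
      using order_isomorphic_spread[of x "max m x" y \<rho> "Suc c"] xy by simp
  }
  assume iso: "order_isomorphic (take (length \<rho> + Suc c) w) (map Suc \<rho> @ replicate (Suc c) 1)"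
  define p w' r v where "p = take (length \<rho>) w" and "w' = tl p"
    and "r = take (Suc c) (drop (length \<rho>) w)" and "v = drop (length \<rho> + Suc c) w"
  define x y where "x = hd p" and "y = hd r"
  have lens: "length p = length \<rho>" "length r = Suc c" using len by (auto simp: p_def r_def)
  have p: "p = x # w'" "length w' = length u"
    using lens \<rho> by (auto simp: x_def w'_def length_Suc_conv)
  have take: "take (length \<rho> + Suc c) w = p @ r"
    unfolding p_def r_def by (rule take_add)
  have w_eq: "w = p @ r @ v"
    using take append_take_drop_id[of "length \<rho> + Suc c" w] unfolding v_def by simp
  let ?l = "p @ r" and ?t = "map Suc \<rho> @ replicate (Suc c) (1::nat)"
  note iso = order_isomorphic_nth[OF iso[unfolded take]]
  have p_iso: "order_isomorphic p \<rho>"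
    unfolding order_isomorphic_def
  proof (intro conjI allI impI)
    fix i j assume ij: "i < length p" "j < length p"
    then show "p ! i < p ! j \<longleftrightarrow> \<rho> ! i < \<rho> ! j" "p ! i = p ! j \<longleftrightarrow> \<rho> ! i = \<rho> ! j"
      using iso[of i j] lens by (simp_all add: nth_append)
  qed (rule lens)
  have l_nth: "?l ! (length \<rho> + j) = r ! j" for j
    using lens by (simp add: nth_append)
  have t_nth: "?t ! (length \<rho> + j) = 1" if "j < Suc c" for j
    using that by (simp add: nth_append del: replicate_Suc)
  have r_eq: "r ! j = r ! 0" if "j < Suc c" for j
    using iso(2)[of "length \<rho> + j" "length \<rho> + 0"] that lens t_nth[of j] t_nth[of 0]
      l_nth[of j] l_nth[of 0] by simp
  have y: "y = r ! 0" using lens by (cases r) (auto simp: y_def)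
  have r: "r = replicate (Suc c) y"
  proof (rule nth_equalityI)
    fix i assume i: "i < length r"
    then have "replicate (Suc c) y ! i = y" by (simp add: lens del: replicate_Suc)
    moreover have "r ! i = y" unfolding y by (rule r_eq) (use i lens in simp)
    ultimately show "r ! i = replicate (Suc c) y ! i" by (simp only:)
  qed (simp add: lens)
  have "y < x"
    using iso(1)[of "length \<rho> + 0" 0] lens p \<rho> y t_nth[of 0] l_nth[of 0] by simp
  have x: "x \<in> insert (Suc m) S"
    and nc': "nc_word {z \<in> insert (Suc m) S. z \<le> x} (max m x) (w' @ r @ v)"
    using w w_eq p by auto
  \<comment> \<open>Being smaller than \<open>x \<le> Suc m\<close>, the letter \<open>y\<close> is
    old; since it occurs again it must be open.\<close>
  have "y \<in> set w" using w_eq r by simp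
  moreover have "y \<le> m" using \<open>y < x\<close> x S by auto
  ultimately have "y \<in> S" using w nc_word_iff[OF S] by blast
  have "{z \<in> insert (Suc m) S. z \<le> x} \<subseteq> {1..max m x}" using S by auto
  note nc' = nc'[unfolded nc_word_iff[OF this]]
  have w'_ge: "x \<le> z" if z: "z \<in> set w'" for z
  proof -
    obtain j where "j < length w'" "w' ! j = z" using z by (auto simp: in_set_conv_nth)
    then show ?thesis
      using order_isomorphic_nth(1)[OF p_iso, of "Suc j" 0] p \<rho> pos_u[of j] by auto
  qed
  have rgf_prefix: "rgf k a" if "rgf k (a @ b)" for k a b
    using that by (induction a arbitrary: k) auto
  have "w' = map (spread x (max m x)) u"
  proof (rule order_isomorphic_rgf_imp_spread[where q = "[1]" and k = 1])
    show "order_isomorphic (map (spread x (max m x)) [1] @ w') ([1] @ u)"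
      using p_iso p \<rho> by (simp add: spread_def)
    show "rgf (max m x + 1 - 1) w'" using nc' rgf_prefix by auto
    \<comment> \<open>After \<open>x\<close> an old letter can recur only if it is at most
      \<open>x\<close>, whereas letters of \<open>w'\<close> are at least \<open>x\<close> because 1
      is the least letter of \<open>\<rho>\<close>.\<close>
    show "\<forall>z\<in>set w'. z \<le> max m x \<longrightarrow> z = x"
      using nc' w'_ge by (auto intro: antisym)
  qed (use rgf_u in auto)
  then have "p = map (spread x (max m x)) \<rho>" using p \<rho> by (simp add: spread_def)
  then have "w = map (spread x (max m x)) \<rho> @ replicate (Suc c) y @ v" using w_eq r by simp
  then show "\<exists>x\<in>insert (Suc m) S. \<exists>y\<in>S. y < x \<and>
      (\<exists>v. w = map (spread x (max m x)) \<rho> @ replicate (Suc c) y @ v)"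
    using x \<open>y \<in> S\<close> \<open>y < x\<close> by blast
qed

text \<open>Such words correspond to triples \<open>(x, y, v)\<close>. If \<open>x\<close> has rank
  \<open>i\<close> among the possible letters, there are \<open>i - 1\<close> choices of
  \<open>y\<close>; the one of rank \<open>j\<close> leaves \<open>j\<close> letters open and thus
  \<open>walks k j\<close> choices of \<open>v\<close>.\<close>

lemma card_prefix_occurrences:
  assumes S: "S \<subseteq> {1..m}" and u: "nc_word {1} 1 u" and \<rho>: "\<rho> = 1 # u"
    and n: "n = length \<rho> + Suc c + k"
  shows "card {w \<in> nc_words S m n.
      order_isomorphic (take (length \<rho> + Suc c) w) (map Suc \<rho> @ replicate (Suc c) 1)} =
    (\<Sum>i=1..Suc (card S). \<Sum>j=1..<i. walks k j)"
proof -
  let ?A = "insert (Suc m) S"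
  let ?N = "\<lambda>x y. nc_words {z \<in> S. z \<le> y} (max m x + fold max u 1 - 1) k"
  let ?T = "SIGMA x:?A. SIGMA y:{y \<in> S. y < x}. ?N x y"
  let ?f = "\<lambda>(x, y, v). map (spread x (max m x)) \<rho> @ replicate (Suc c) y @ v"
  have fin: "finite S" using S finite_subset by blast
  have "{w \<in> nc_words S m n.
      order_isomorphic (take (length \<rho> + Suc c) w) (map Suc \<rho> @ replicate (Suc c) 1)} =
    {w \<in> nc_words S m n. \<exists>x\<in>?A. \<exists>y\<in>S. y < x \<and> (\<exists>v. w = ?f (x, y, v))}"
  proof (rule Collect_cong, rule conj_cong[OF refl])
    fix w assume "w \<in> nc_words S m n"
    then have "nc_word S m w" "length \<rho> + Suc c \<le> length w" using n by (auto simp: nc_words_def)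
    from order_isomorphic_pattern_iff[OF S this(1) u \<rho> this(2)]
    show "order_isomorphic (take (length \<rho> + Suc c) w) (map Suc \<rho> @ replicate (Suc c) 1) \<longleftrightarrow>
        (\<exists>x\<in>?A. \<exists>y\<in>S. y < x \<and> (\<exists>v. w = ?f (x, y, v)))"
      by (simp only: case_prod_conv)
  qed
  also have "\<dots> = ?f ` ?T"
  proof (intro set_eqI iffI)
    fix w assume "w \<in> {w \<in> nc_words S m n. \<exists>x\<in>?A. \<exists>y\<in>S. y < x \<and> (\<exists>v. w = ?f (x, y, v))}"
    then obtain x y v where *: "w \<in> nc_words S m n" "x \<in> ?A" "y \<in> S" "y < x" "w = ?f (x, y, v)"
      by blast
    have "nc_word S m (map (spread x (max m x)) (1 # u) @ replicate (Suc c) y @ v)"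
      using * \<rho> by (simp add: nc_words_def)
    then have "nc_word {z \<in> S. z \<le> y} (max m x + fold max u 1 - 1) v"
      using nc_word_occurrence_iff[OF u *(2,3,4) S] by blast
    moreover have "length v = k" using * n by (simp add: nc_words_def)
    ultimately have "(x, y, v) \<in> ?T" using * by (simp add: nc_words_def)
    then show "w \<in> ?f ` ?T" using *(5) by (rule rev_image_eqI)
  next
    fix w assume "w \<in> ?f ` ?T"
    then obtain x y v where *: "x \<in> ?A" "y \<in> S" "y < x" "w = ?f (x, y, v)"
      and v: "nc_word {z \<in> S. z \<le> y} (max m x + fold max u 1 - 1) v" "length v = k"
      by (auto simp: nc_words_def)
    have "nc_word S m (map (spread x (max m x)) (1 # u) @ replicate (Suc c) y @ v)"
      using nc_word_occurrence_iff[OF u *(1,2,3) S] v by blast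
    then have "w \<in> nc_words S m n" using *(4) \<rho> v n by (simp add: nc_words_def)
    with * show "w \<in> {w \<in> nc_words S m n. \<exists>x\<in>?A. \<exists>y\<in>S. y < x \<and> (\<exists>v. w = ?f (x, y, v))}" by blast
  qed
  finally have "card {w \<in> nc_words S m n.
      order_isomorphic (take (length \<rho> + Suc c) w) (map Suc \<rho> @ replicate (Suc c) 1)} = card (?f ` ?T)"
    by simp
  also have "\<dots> = card ?T"
  proof (rule card_image, rule inj_onI)
    fix s t assume eq: "?f s = ?f t"
    obtain x y v x' y' v' where st: "s = (x, y, v)" "t = (x', y', v')" by (cases s, cases t) auto
    have "x = x'" using eq st \<rho> by (simp add: spread_def)
    then show "s = t" using eq st by simp
  qed
  also have "\<dots> = (\<Sum>x\<in>?A. \<Sum>y\<in>{y \<in> S. y < x}. card (?N x y))"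
    using fin by (simp add: card_SigmaI finite_nc_words del: sum.insert)
  also have "\<dots> = (\<Sum>x\<in>?A. \<Sum>j=1..<card {y \<in> ?A. y \<le> x}. walks k j)"
  proof (rule sum.cong[OF refl])
    fix x assume x: "x \<in> ?A"
    let ?B = "{y \<in> S. y < x}"
    have "(\<Sum>y\<in>?B. card (?N x y)) = (\<Sum>y\<in>?B. walks k (card {z \<in> ?B. z \<le> y}))"
    proof (rule sum.cong[OF refl])
      fix y assume y: "y \<in> ?B"
      then have "{z \<in> ?B. z \<le> y} = {z \<in> S. z \<le> y}" by auto
      moreover have "{z \<in> S. z \<le> y} \<subseteq> {1..max m x + fold max u 1 - 1}"
        using y S le_fold_max[of 1 u] by (fastforce)
      ultimately show "card (?N x y) = walks k (card {z \<in> ?B. z \<le> y})"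
        by (simp add: card_nc_words)
    qed
    also have "\<dots> = (\<Sum>j=1..card ?B. walks k j)"
      by (rule sum_rank) (use fin in simp)
    also have "{1..card ?B} = {1..<card {y \<in> ?A. y \<le> x}}"
    \<comment> \<open>The rank of \<open>x\<close> counts \<open>x\<close> itself while
      \<open>y\<close> is strictly smaller, which makes the upper limit of the inner sum
      strict.\<close>
    proof -
      have "{y \<in> ?A. y \<le> x} = insert x ?B" using x S by auto
      then have "card {y \<in> ?A. y \<le> x} = Suc (card ?B)" using fin by simp
      then show ?thesis by auto
    qed
    finally show "(\<Sum>y\<in>?B. card (?N x y)) = (\<Sum>j=1..<card {y \<in> ?A. y \<le> x}. walks k j)" .
  qed
  also have "\<dots> = (\<Sum>i=1..card ?A. \<Sum>j=1..<i. walks k j)"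
    by (rule sum_rank) (use fin in simp)
  finally show ?thesis by (simp only: card_insert_Suc_max[OF S])
qed

section \<open>Summation over all positions and all words\<close>

lemma occurrences_Cons:
  "occurrences t (x # w) =
    (if length t \<le> Suc (length w) \<and> order_isomorphic (take (length t) (x # w)) t then 1 else 0)
    + occurrences t w"
proof -
  define Q where "Q w = {i. i + length t \<le> length w \<and> order_isomorphic (take (length t) (drop i w)) t}"
    for w :: "nat list"
  have fin: "finite (Q w)" for w by (rule finite_subset[of _ "{..length w}"]) (auto simp: Q_def)
  have "i \<in> Q (x # w) \<longleftrightarrow> i \<in> (if length t \<le> Suc (length w) \<and>
      order_isomorphic (take (length t) (x # w)) t then {0} else {}) \<union> Suc ` Q w" for i
    by (cases i) (auto simp: Q_def)
  then have "Q (x # w) = (if length t \<le> Suc (length w) \<and>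
      order_isomorphic (take (length t) (x # w)) t then {0} else {}) \<union> Suc ` Q w"
    by blast
  then have "card (Q (x # w)) = (if length t \<le> Suc (length w) \<and>
      order_isomorphic (take (length t) (x # w)) t then 1 else 0) + card (Q w)"
    using fin[of w] by (auto simp: card_insert_if card_image)
  then show ?thesis by (simp add: occurrences_def Q_def)
qed

text \<open>An occurrence is either at the front, counted by \<open>card_prefix_occurrences\<close>,
  or in the tail, covered by the induction hypothesis after the first letter. This is the recursion
  of \<open>marked_walks\<close>, so only the length of \<open>\<tau>\<close> matters.\<close>

lemma sum_occurrences:
  assumes u: "nc_word {1} 1 u" and \<rho>: "\<rho> = 1 # u"
    and \<tau>: "\<tau> = map Suc \<rho> @ replicate (Suc c) 1" and S: "S \<subseteq> {1..m}"
  shows "(\<Sum>w\<in>nc_words S m n. occurrences \<tau> w) =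
    (if n < length \<tau> then 0 else marked_walks (n - length \<tau>) (card S))"
  using S
proof (induction n arbitrary: S m)
  case 0
  then show ?case by (simp add: nc_words_0 occurrences_def \<tau>)
next
  case (Suc n)
  let ?A = "insert (Suc m) S"
  let ?P = "\<lambda>w. length \<tau> \<le> length w \<and> order_isomorphic (take (length \<tau>) w) \<tau>"
  have fin: "finite S" using Suc.prems finite_subset by blast
  have "(\<Sum>w\<in>nc_words S m (Suc n). occurrences \<tau> w) =
      (\<Sum>w\<in>nc_words S m (Suc n). (if ?P w then 1 else 0) + occurrences \<tau> (tl w))"
  proof (rule sum.cong[OF refl])
    fix w assume "w \<in> nc_words S m (Suc n)"
    then obtain x v where "w = x # v" by (auto simp: nc_words_def length_Suc_conv)
    then show "occurrences \<tau> w = (if ?P w then 1 else 0) + occurrences \<tau> (tl w)"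
      by (simp add: occurrences_Cons)
  qed
  also have "\<dots> = card {w \<in> nc_words S m (Suc n). ?P w} +
      (\<Sum>w\<in>nc_words S m (Suc n). occurrences \<tau> (tl w))"
    using finite_nc_words[OF fin, of m "Suc n"] by (simp add: sum.distrib sum.If_cases Int_def)
  also have "(\<Sum>w\<in>nc_words S m (Suc n). occurrences \<tau> (tl w)) =
      (\<Sum>x\<in>?A. \<Sum>w\<in>nc_words {y \<in> ?A. y \<le> x} (max m x) n. occurrences \<tau> w)"
    using fin by (simp add: sum_nc_words_Suc del: sum.insert)
  also have "\<dots> = (\<Sum>x\<in>?A. if n < length \<tau> then 0
      else marked_walks (n - length \<tau>) (card {y \<in> ?A. y \<le> x}))"
    by (rule sum.cong[OF refl], rule Suc.IH) (use Suc.prems in auto)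
  also have "\<dots> = (\<Sum>j=1..card ?A. if n < length \<tau> then 0 else marked_walks (n - length \<tau>) j)"
    by (rule sum_rank) (use fin in simp)
  finally have rec: "(\<Sum>w\<in>nc_words S m (Suc n). occurrences \<tau> w) =
      card {w \<in> nc_words S m (Suc n). ?P w} +
      (\<Sum>j=1..Suc (card S). if n < length \<tau> then 0 else marked_walks (n - length \<tau>) j)"
    by (simp only: card_insert_Suc_max[OF Suc.prems])
  show ?case
  proof (cases "Suc n < length \<tau>")
    case True
    then have "{w \<in> nc_words S m (Suc n). ?P w} = {}" by (auto simp: nc_words_def)
    with True rec show ?thesis by simp
  next
    case False
    have len: "length \<tau> = length \<rho> + Suc c" using \<tau> by simp
    have "{w \<in> nc_words S m (Suc n). ?P w} = {w \<in> nc_words S m (Suc n).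
        order_isomorphic (take (length \<rho> + Suc c) w) (map Suc \<rho> @ replicate (Suc c) 1)}"
      using False unfolding len \<tau>[symmetric] by (auto simp: nc_words_def)
    then have "card {w \<in> nc_words S m (Suc n). ?P w} =
        (\<Sum>i=1..Suc (card S). \<Sum>j=1..<i. walks (Suc n - length \<tau>) j)"
      using card_prefix_occurrences[OF Suc.prems u \<rho>, of "Suc n" c "Suc n - length \<tau>"] False len
      by simp
    note rec' = rec[unfolded this]
    show ?thesis
    proof (cases "n < length \<tau>")
      case True
      \<comment> \<open>Here the pattern fills the whole word: the tail is too short for an
        occurrence, and the base case of \<open>marked_walks\<close> applies.\<close>
      then have "Suc n - length \<tau> = 0" by simp
      then show ?thesis using rec' True False by simp
    next
      case le: False
      then have "Suc n - length \<tau> = Suc (n - length \<tau>)" by simp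
      then show ?thesis using rec' le False by (simp only: marked_walks.simps if_False)
    qed
  qed
qed

theorem corollary5:
  fixes a b n :: nat and \<rho> :: "nat list"
  assumes "a \<ge> 1" and "b \<ge> 1"
    and "\<rho> \<in> NC a"
    and "b \<ge> 2 \<Longrightarrow> length (takeWhile (\<lambda>x. x = 1) \<rho>) = 1"
    and "n \<ge> a + b - 1"
  shows "let \<tau> = map (\<lambda>x. x + 1) \<rho> @ replicate b 1; r = n + 2 - (a + b)
         in (\<Sum>\<pi>\<in>NC n. occurrences \<tau> \<pi>) = (2 * r - 2) choose (r + 1)"
proof -
  obtain c where b: "b = Suc c" using assms(2) by (cases b) auto
  have \<rho>: "length \<rho> = a" "nc_word {} 0 \<rho>" using assms(3) by (auto simp: NC_eq_nc_word)
  then obtain x u where xu: "\<rho> = x # u" using assms(1) by (cases \<rho>) auto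
  with \<rho> have x: "x = 1" by simp
  \<comment> \<open>The first letter of \<open>\<rho>\<close> is 1, so the rest is read from the
    state \<open>({1}, 1)\<close>.\<close>
  have "{y \<in> insert (Suc 0) {}. y \<le> Suc 0} = {1}" by auto
  with \<rho> xu x have u: "nc_word {1} 1 u" by simp
  define \<tau> where "\<tau> = map Suc \<rho> @ replicate (Suc c) 1"
  have len: "length \<tau> = a + b" by (simp add: \<tau>_def \<rho> b)
  have NC: "NC n = nc_words {} 0 n" by (simp add: NC_eq_nc_word nc_words_def)
  have sum: "(\<Sum>\<pi>\<in>NC n. occurrences \<tau> \<pi>) = (if n < a + b then 0 else marked_walks (n - (a + b)) 0)"
    using sum_occurrences[OF u xu[unfolded x] \<tau>_def, of "{}" 0 n] by (simp add: NC len)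
  have "(\<Sum>\<pi>\<in>NC n. occurrences \<tau> \<pi>) = (2 * (n + 2 - (a + b)) - 2) choose (n + 2 - (a + b) + 1)"
  proof (cases "n < a + b")
    case True
    \<comment> \<open>In the extreme case \<open>n = a + b - 1\<close> no occurrence fits, in
      agreement with \<open>0 choose 2 = 0\<close>.\<close>
    then have "n + 2 - (a + b) = 1" using assms(5) by simp
    then show ?thesis using True sum by simp
  next
    case False
    then obtain k where "n = a + b + k" by (metis leI le_Suc_ex)
    then show ?thesis using sum by (simp add: marked_walks_0 numeral_eq_Suc del: binomial_Suc_Suc marked_walks.simps)
  qed
  then show ?thesis by (simp add: \<tau>_def b)
qed

end
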